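(* Let $(\mathcal{M},\approx_{\mathcal{I}})$ be a $\mathfrak{D}$-set. Then its internal system $\mathcal{AP}(\mathcal{M})$ is a system which satisfies, for all $i\in\mathcal{I}$ and $A_i,B_i\in\mathcal{M}/{\approx_i}$, $$A_i\asymp B_i\iff A_i\overset{p}{\mapsto}B_i\iff A_i=B_i .$$ Moreover $(\mathcal{M},\in)$ is a target for the system $\mathcal{AP}(\mathcal{M})$, that is, $\mathcal{M}$ is a target with respect to the relations defined by $$a\overset{p}{\longmapsto}A_i\;:\iff\; a\in A_i .$$ For this target, the extension of $a\in\mathcal{M}$ is $Ext(a)=\{A_i\in\bigcup_{i\in\mathcal{I}}\mathcal{M}/{\approx_i}\mid a\in A_i\}$, and $a\approx_i b\iff a,b\in A_i$ for some $A_i\in\mathcal{M}/{\approx_i}$; so the definition of $\overset{p}{\longmapsto}$ is in line with the rule that $a\approx_i b$ holds iff $a\overset{p}{\longmapsto}A_i$ and $b\overset{p}{\longmapsto}B_i$ for some $A_i\asymp B_i$ in $\mathcal{M}/{\approx_i}$.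
   Context: Index sets $\mathcal{I},\mathcal{J},\dots$ are non-empty directed preordered sets (products carry the product order). For each index set $\mathcal{I}$ (including products) a set $\mathfrak{D}(\mathcal{I})\subseteq\mathcal{P}(\mathcal{I})$ is fixed. Standing assumptions: $\mathfrak{D}(\mathcal{I})$ is a proper filter of subsets of $\mathcal{I}$, all of whose members are cofinal, and it contains all non-empty up-sets; and if $\mathcal{H}\in\mathfrak{D}(\mathcal{I}\times\mathcal{J})$ and $\mathcal{I}'\in\mathfrak{D}(\mathcal{I})$, then $\{j\in\mathcal{J}\mid\exists i\in\mathcal{I}'\ (i,j)\in\mathcal{H}\}\in\mathfrak{D}(\mathcal{J})$. A system $(\mathcal{M}_{\mathcal{I}},\overset{p}{\mapsto})$ is a family of finite sets $(\mathcal{M}_i)_{i\in\mathcal{I}}$ (regarded as disjoint) with relations $\overset{p}{\mapsto}\subseteq\mathcal{M}_{i'}\times\mathcal{M}_i$ for $i'\ge i$, reflexive for $i=i'$. Elements $a_i\in\mathcal{M}_i$, $b_j\in\mathcal{M}_j$ are consistent, $a_i\asymp b_j$, iff there are $i'\ge i,j$ and $a_{i'}\in\mathcal{M}_{i'}$ with $a_{i'}\overset{p}{\mapsto}a_i$ and $a_{i'}\overset{p}{\mapsto}b_j$. A target for a system is a set $\mathcal{M}$ with relations $\overset{p}{\longmapsto}\subseteq\mathcal{M}\times\mathcal{M}_i$ ($i\in\mathcal{I}$) such that $\{i\in\mathcal{I}\mid\exists a_i\in\mathcal{M}_i\ a\overset{p}{\longmapsto}a_i\}\in\mathfrak{D}(\mathcal{I})$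 for all $a\in\mathcal{M}$. The extension of $a\in\mathcal{M}$ is $Ext(a):=\{a_i\in\bigcup_{i}\mathcal{M}_i\mid a\overset{p}{\longmapsto}a_i\}$. For a family $\approx_{\mathcal{I}}=(\approx_i)_{i\in\mathcal{I}}$ of partial equivalence relations (PERs: symmetric and transitive) on $\mathcal{M}$ put $[i]:=\{a\in\mathcal{M}\mid a\approx_i a\}$ and $\mathcal{I}_a:=\{i\in\mathcal{I}\mid a\in[i]\}$. $(\mathcal{M},\approx_{\mathcal{I}})$ is a $\mathfrak{D}$-set iff each $\approx_i$ is a PER on $\mathcal{M}$; $\mathcal{I}_a\in\mathfrak{D}(\mathcal{I})$ for all $a\in\mathcal{M}$ (dense); and $a\approx_{i'}b$ and $a,b\in[i]$ imply $a\approx_i b$ for all $i\le i'$, $a,b\in\mathcal{M}$ (approximating). Standing assumption: each $\approx_i$ has only finitely many equivalence classes. $\mathcal{M}/{\approx_i}$ denotes the set of (non-empty) equivalence classes of $\approx_i$ on $[i]$. The internal system of $(\mathcal{M},\approx_{\mathcal{I}})$ is $\mathcal{AP}(\mathcal{M}):=((\mathcal{M}/{\approx_i})_{i\in\mathcal{I}},\overset{p}{\mapsto})$ with $A_{i'}\overset{p}{\mapsto}A_i:\iff A_{i'}\cap A_i\neq\emptyset$ for $i'\ge i$. *)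

theory Defs
  imports Main
begin

text \<open>
  A preordered set is represented by its relation \<open>r\<close> (read \<open>(i, j) \<in> r\<close> as \<open>i \<le> j\<close>);
  by reflexivity its underlying set is \<open>Field r\<close>.

  The assignment of the filters \<open>\<DD>(I)\<close> ranges over all index sets, including products
  of index sets, products of products, and so on.  To make it a single function, index sets
  live in the type \<open>'i idx\<close>, which contains a copy of \<open>'i\<close> and is closed under ordered pairs;
  \<open>'i\<close> is arbitrary.
\<close>

datatype 'i idx = Elt 'i | Tup "'i idx" "'i idx"

definition index_set :: "'u rel \<Rightarrow> bool" where
  "index_set r \<longleftrightarrow> Preorder r \<and> Field r \<noteq> {} \<and>
     (\<forall>i\<in>Field r. \<forall>j\<in>Field r. \<exists>k. (i, k) \<in> r \<and> (j, k) \<in> r)"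

definition prod_order :: "'i idx rel \<Rightarrow> 'i idx rel \<Rightarrow> 'i idx rel" where
  "prod_order r s = {(Tup i j, Tup i' j') | i j i' j'. (i, i') \<in> r \<and> (j, j') \<in> s}"

definition cofinal_in :: "'u rel \<Rightarrow> 'u set \<Rightarrow> bool" where
  "cofinal_in r H \<longleftrightarrow> H \<subseteq> Field r \<and> (\<forall>i\<in>Field r. \<exists>h\<in>H. (i, h) \<in> r)"

definition up_set :: "'u rel \<Rightarrow> 'u set \<Rightarrow> bool" where
  "up_set r U \<longleftrightarrow> U \<subseteq> Field r \<and> (\<forall>i\<in>U. \<forall>j. (i, j) \<in> r \<longrightarrow> j \<in> U)"

definition proper_set_filter :: "'u set \<Rightarrow> 'u set set \<Rightarrow> bool" where
  "proper_set_filter I F \<longleftrightarrow> F \<subseteq> Pow I \<and> I \<in> F \<and> {} \<notin> F \<and>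
     (\<forall>A\<in>F. \<forall>B\<in>F. A \<inter> B \<in> F) \<and>
     (\<forall>A\<in>F. \<forall>B. A \<subseteq> B \<and> B \<subseteq> I \<longrightarrow> B \<in> F)"

definition filter_assignment :: "('i idx rel \<Rightarrow> 'i idx set set) \<Rightarrow> bool" where
  "filter_assignment D \<longleftrightarrow>
     (\<forall>r. index_set r \<longrightarrow>
        proper_set_filter (Field r) (D r) \<and>
        (\<forall>H\<in>D r. cofinal_in r H) \<and>
        (\<forall>U. up_set r U \<and> U \<noteq> {} \<longrightarrow> U \<in> D r)) \<and>
     (\<forall>r s. index_set r \<and> index_set s \<longrightarrow>
        (\<forall>H\<in>D (prod_order r s). \<forall>I'\<in>D r.
           {j \<in> Field s. \<exists>i\<in>I'. Tup i j \<in> H} \<in> D s))"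

text \<open>
  The sets of a system are regarded as disjoint, so an element \<open>a\<close> of the \<open>i\<close>-th set is
  represented by the pair \<open>(i, a)\<close>.  A pair \<open>(x, y)\<close> of such elements in \<open>maps\<close> means that
  \<open>x\<close> is related to \<open>y\<close>, where the index of \<open>x\<close> is the larger one.
\<close>

record ('u, 'm) system =
  obj :: "'u \<Rightarrow> 'm set"
  maps :: "('u \<times> 'm) rel"

definition elements :: "'u rel \<Rightarrow> ('u, 'm) system \<Rightarrow> ('u \<times> 'm) set" where
  "elements r S = Sigma (Field r) (obj S)"

definition is_system :: "'u rel \<Rightarrow> ('u, 'm) system \<Rightarrow> bool" where
  "is_system r S \<longleftrightarrow> index_set r \<and>
     (\<forall>i\<in>Field r. finite (obj S i)) \<and>
     maps S \<subseteq> {(x, y). x \<in> elements r S \<and> y \<in> elements r S \<and> (fst y, fst x) \<in> r} \<and>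
     (\<forall>x\<in>elements r S. (x, x) \<in> maps S)"

definition consistent :: "'u rel \<Rightarrow> ('u, 'm) system \<Rightarrow> 'u \<times> 'm \<Rightarrow> 'u \<times> 'm \<Rightarrow> bool" where
  "consistent r S x y \<longleftrightarrow> (\<exists>z\<in>elements r S. (fst x, fst z) \<in> r \<and> (fst y, fst z) \<in> r \<and>
     (z, x) \<in> maps S \<and> (z, y) \<in> maps S)"

definition is_target ::
  "('u rel \<Rightarrow> 'u set set) \<Rightarrow> 'u rel \<Rightarrow> ('u, 'm) system \<Rightarrow> 'a set \<Rightarrow> ('a \<times> ('u \<times> 'm)) set \<Rightarrow> bool"
where
  "is_target D r S M T \<longleftrightarrow> T \<subseteq> M \<times> elements r S \<and>
     (\<forall>a\<in>M. {i \<in> Field r. \<exists>A\<in>obj S i. (a, (i, A)) \<in> T} \<in> D r)"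

definition Ext :: "'u rel \<Rightarrow> ('u, 'm) system \<Rightarrow> ('a \<times> ('u \<times> 'm)) set \<Rightarrow> 'a \<Rightarrow> ('u \<times> 'm) set" where
  "Ext r S T a = {x \<in> elements r S. (a, x) \<in> T}"

definition per_on :: "'a set \<Rightarrow> 'a rel \<Rightarrow> bool" where
  "per_on M R \<longleftrightarrow> R \<subseteq> M \<times> M \<and> sym R \<and> trans R"

definition stage :: "'a set \<Rightarrow> ('u \<Rightarrow> 'a rel) \<Rightarrow> 'u \<Rightarrow> 'a set" where
  "stage M E i = {a \<in> M. (a, a) \<in> E i}"

definition classes :: "'a set \<Rightarrow> ('u \<Rightarrow> 'a rel) \<Rightarrow> 'u \<Rightarrow> 'a set set" where
  "classes M E i = stage M E i // E i"

definition D_set ::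
  "('u rel \<Rightarrow> 'u set set) \<Rightarrow> 'u rel \<Rightarrow> 'a set \<Rightarrow> ('u \<Rightarrow> 'a rel) \<Rightarrow> bool" where
  "D_set D r M E \<longleftrightarrow>
     (\<forall>i\<in>Field r. per_on M (E i)) \<and>
     (\<forall>a\<in>M. {i \<in> Field r. a \<in> stage M E i} \<in> D r) \<and>
     (\<forall>i i'. \<forall>a\<in>M. \<forall>b\<in>M. (i, i') \<in> r \<and> (a, b) \<in> E i' \<and> a \<in> stage M E i \<and> b \<in> stage M E i
        \<longrightarrow> (a, b) \<in> E i)"

definition internal_system ::
  "'u rel \<Rightarrow> 'a set \<Rightarrow> ('u \<Rightarrow> 'a rel) \<Rightarrow> ('u, 'a set) system" where
  "internal_system r M E =
     \<lparr>obj = classes M E,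
      maps = {((i', A'), (i, A)) | i' A' i A.
        (i, i') \<in> r \<and> A' \<in> classes M E i' \<and> A \<in> classes M E i \<and> A' \<inter> A \<noteq> {}}\<rparr>"

definition mem_rel ::
  "'u rel \<Rightarrow> 'a set \<Rightarrow> ('u \<Rightarrow> 'a rel) \<Rightarrow> ('a \<times> ('u \<times> 'a set)) set" where
  "mem_rel r M E = {(a, (i, A)) | a i A. a \<in> M \<and> i \<in> Field r \<and> A \<in> classes M E i \<and> a \<in> A}"

end

theory Submission
  imports Defs
begin

text \<open>
  A class at a finer index meeting two classes at index \<open>i\<close> yields two points that are related
  at the finer index; as \<open>\<approx>\<close> is approximating they are related at \<open>i\<close>, so the two classes
  coincide.  Density is exactly the target condition, because \<open>a\<close> lies in some class at \<open>i\<close>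
  iff \<open>a \<approx>\<^sub>i a\<close>.
\<close>

text \<open>From \<open>a \<approx> b\<close>, symmetry and transitivity give
  \<open>a \<approx> a\<close> and \<open>b \<approx> b\<close>, so a PER never leaves its stage and
  is reflexive there. The quotient library for \<open>equiv\<close> thereby becomes available for
  \<open>classes\<close>.\<close>

lemma equiv_stage:
  assumes "per_on M (E i)"
  shows "equiv (stage M E i) (E i)"
proof (rule equivI)
  show "E i \<subseteq> stage M E i \<times> stage M E i"
  proof (rule subrelI)
    fix a b assume "(a, b) \<in> E i"
    moreover from this have "(b, a) \<in> E i"
      using assms by (auto simp: per_on_def dest: symD)
    ultimately show "(a, b) \<in> stage M E i \<times> stage M E i"
      using assms by (auto simp: per_on_def stage_def dest: transD)
  qed
  show "refl_on (stage M E i) (E i)" by (simp add: refl_on_def stage_def)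
  show "sym (E i)" "trans (E i)" using assms by (simp_all add: per_on_def)
qed

locale fixed_D_set =
  fixes D :: "'u rel \<Rightarrow> 'u set set" and r :: "'u rel"
    and M :: "'a set" and E :: "'u \<Rightarrow> 'a rel"
  assumes index: "index_set r" and D_set: "D_set D r M E"
begin

abbreviation AP :: "('u, 'a set) system" where "AP \<equiv> internal_system r M E"

lemma index_refl: "i \<in> Field r \<Longrightarrow> (i, i) \<in> r"
  using index by (auto simp: index_set_def preorder_on_def refl_on_def)

lemma equiv: "i \<in> Field r \<Longrightarrow> equiv (stage M E i) (E i)"
  using D_set by (simp add: D_set_def equiv_stage)

lemma approximating:
  "\<lbrakk>(i, i') \<in> r; (a, b) \<in> E i'; a \<in> stage M E i; b \<in> stage M E i\<rbrakk> \<Longrightarrow> (a, b) \<in> E i"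
  using D_set unfolding D_set_def stage_def by blast

lemma class_subset:
  assumes "i \<in> Field r" "A \<in> classes M E i"
  shows "A \<subseteq> stage M E i"
  using in_quotient_imp_subset[OF equiv[OF assms(1)] assms(2)[unfolded classes_def]] .

lemma class_nonempty: "\<lbrakk>i \<in> Field r; A \<in> classes M E i\<rbrakk> \<Longrightarrow> A \<noteq> {}"
  unfolding classes_def by (rule in_quotient_imp_non_empty[OF equiv])

lemma class_eq_iff:
  assumes "i \<in> Field r" "A \<in> classes M E i" "B \<in> classes M E i" "a \<in> A" "b \<in> B"
  shows "A = B \<longleftrightarrow> (a, b) \<in> E i"
  using quotient_eq_iff[OF equiv[OF assms(1)] assms(2,3)[unfolded classes_def] assms(4,5)] .

lemma in_stage_iff:
  assumes "i \<in> Field r"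
  shows "a \<in> stage M E i \<longleftrightarrow> (\<exists>A\<in>classes M E i. a \<in> A)"
  using Union_quotient[OF equiv[OF assms]] by (auto simp: classes_def)

text \<open>Membership of \<open>a\<close> and \<open>b\<close> in \<open>M\<close> need not be
  assumed: either side already places both points in the stage, where the classes form a
  partition.\<close>

lemma related_iff:
  assumes i: "i \<in> Field r"
  shows "(a, b) \<in> E i \<longleftrightarrow> (\<exists>A\<in>classes M E i. a \<in> A \<and> b \<in> A)"
proof
  assume ab: "(a, b) \<in> E i"
  then have "a \<in> stage M E i" "b \<in> stage M E i"
    using equiv[OF i] by (auto simp: equiv_def)
  then obtain A B where "A \<in> classes M E i" "a \<in> A" "B \<in> classes M E i" "b \<in> B"
    using in_stage_iff[OF i] by blast
  then show "\<exists>A\<in>classes M E i. a \<in> A \<and> b \<in> A"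
    using class_eq_iff[OF i] ab by blast
next
  assume "\<exists>A\<in>classes M E i. a \<in> A \<and> b \<in> A"
  then show "(a, b) \<in> E i" using class_eq_iff[OF i] by blast
qed

lemma elements_AP: "elements r AP = Sigma (Field r) (classes M E)"
  by (simp add: elements_def internal_system_def)

lemma maps_AP_iff:
  "((i', A'), (i, A)) \<in> maps AP \<longleftrightarrow>
     (i, i') \<in> r \<and> A' \<in> classes M E i' \<and> A \<in> classes M E i \<and> A' \<inter> A \<noteq> {}"
  by (auto simp: internal_system_def)

text \<open>At one index the relation says only that the two classes meet, and classes of the same
  PER are equal or disjoint. Conversely a class meets itself because it is non-empty, and
  \<open>(i, i) \<in> r\<close> by reflexivity.\<close>

lemma maps_AP_iff_eq:
  assumes "i \<in> Field r" "A \<in> classes M E i" "B \<in> classes M E i"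
  shows "((i, A), (i, B)) \<in> maps AP \<longleftrightarrow> A = B"
  using assms class_nonempty[OF assms(1,2)] index_refl[OF assms(1)]
    quotient_disj[OF equiv[OF assms(1)] assms(2,3)[unfolded classes_def]]
  by (auto simp: maps_AP_iff)

lemma consistent_AP_iff_eq:
  assumes i: "i \<in> Field r" and A: "A \<in> classes M E i" and B: "B \<in> classes M E i"
  shows "consistent r AP (i, A) (i, B) \<longleftrightarrow> A = B"
proof
  assume "consistent r AP (i, A) (i, B)"
  then obtain k C where k: "k \<in> Field r" "(i, k) \<in> r"
    and C: "C \<in> classes M E k" "C \<inter> A \<noteq> {}" "C \<inter> B \<noteq> {}"
    by (auto simp: consistent_def elements_AP maps_AP_iff)
  \<comment> \<open>Choose one point in each intersection. The common class \<open>C\<close> relates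
    them at \<open>k\<close>, and lying in \<open>A\<close> and \<open>B\<close> puts both into the
    stage at \<open>i\<close>, as the approximating condition requires.\<close>
  then obtain a b where ab: "a \<in> C" "a \<in> A" "b \<in> C" "b \<in> B" by blast
  then have "(a, b) \<in> E k" using related_iff k C by blast
  then have "(a, b) \<in> E i"
    using approximating[OF k(2)] class_subset[OF i A] class_subset[OF i B] ab by blast
  then show "A = B" using class_eq_iff[OF i A B] ab by blast
next
  assume "A = B"
  then show "consistent r AP (i, A) (i, B)"
    \<comment> \<open>The class \<open>(i, A)\<close> is its own common refinement.\<close>
    using i A index_refl[OF i] maps_AP_iff_eq[OF i A A]
    by (auto simp: consistent_def elements_AP intro!: bexI[of _ "(i, A)"])
qed

lemma is_system_AP:
  assumes "\<forall>i\<in>Field r. finite (classes M E i)"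
  shows "is_system r AP"
proof -
  have "maps AP \<subseteq> {(x, y). x \<in> elements r AP \<and> y \<in> elements r AP \<and> (fst y, fst x) \<in> r}"
    by (auto simp: maps_AP_iff elements_AP intro: FieldI1 FieldI2)
  \<comment> \<open>Reflexivity is the case \<open>A = B\<close> of
    \<open>maps_AP_iff_eq\<close>.\<close>
  moreover have "\<forall>x\<in>elements r AP. (x, x) \<in> maps AP"
    by (auto simp: elements_AP maps_AP_iff_eq)
  ultimately show ?thesis
    using assms index by (simp add: is_system_def internal_system_def)
qed

lemma is_target_AP: "is_target D r AP M (mem_rel r M E)"
proof -
  \<comment> \<open>The classes at \<open>i\<close> cover exactly the stage, so this index set is
    the one that density puts into \<open>D r\<close>.\<close>
  have "{i \<in> Field r. \<exists>A\<in>obj AP i. (a, (i, A)) \<in> mem_rel r M E}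
      = {i \<in> Field r. a \<in> stage M E i}" if "a \<in> M" for a
    using that in_stage_iff by (auto simp: internal_system_def mem_rel_def)
  moreover have "mem_rel r M E \<subseteq> M \<times> elements r AP"
    by (auto simp: mem_rel_def elements_AP)
  ultimately show ?thesis
    using D_set by (simp add: is_target_def D_set_def)
qed

lemma Ext_AP:
  "a \<in> M \<Longrightarrow> Ext r AP (mem_rel r M E) a =
     {(i, A) | i A. i \<in> Field r \<and> A \<in> classes M E i \<and> a \<in> A}"
  by (auto simp: Ext_def elements_AP mem_rel_def)

text \<open>Both classes sit at the same index, where consistency collapses to equality; the two
  witnesses therefore merge into the single class of \<open>related_iff\<close>.\<close>

lemma related_iff_consistent:
  assumes "i \<in> Field r" "a \<in> M" "b \<in> M"
  shows "(a, b) \<in> E i \<longleftrightarrow> (\<exists>A\<in>classes M E i. \<exists>B\<in>classes M E i.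
    (a, (i, A)) \<in> mem_rel r M E \<and> (b, (i, B)) \<in> mem_rel r M E \<and>
    consistent r AP (i, A) (i, B))"
  using assms by (auto simp: related_iff consistent_AP_iff_eq mem_rel_def)

end

theorem lemma3p7:
  fixes D :: "'i idx rel \<Rightarrow> 'i idx set set"
    and r :: "'i idx rel"
    and M :: "'a set"
    and E :: "'i idx \<Rightarrow> 'a rel"
  assumes "filter_assignment D"
    and "index_set r"
    and "D_set D r M E"
    and "\<forall>i\<in>Field r. finite (classes M E i)"
  shows "(is_system r (internal_system r M E)) \<and>
    (\<forall>i\<in>Field r. \<forall>A\<in>classes M E i. \<forall>B\<in>classes M E i.
           (consistent r (internal_system r M E) (i, A) (i, B) \<longleftrightarrow>
              ((i, A), (i, B)) \<in> maps (internal_system r M E)) \<and>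
           (((i, A), (i, B)) \<in> maps (internal_system r M E) \<longleftrightarrow> A = B)) \<and>
    (is_target D r (internal_system r M E) M (mem_rel r M E)) \<and>
    (\<forall>a\<in>M. Ext r (internal_system r M E) (mem_rel r M E) a =
           {(i, A) | i A. i \<in> Field r \<and> A \<in> classes M E i \<and> a \<in> A}) \<and>
    (\<forall>i\<in>Field r. \<forall>a\<in>M. \<forall>b\<in>M.
           (a, b) \<in> E i \<longleftrightarrow> (\<exists>A\<in>classes M E i. a \<in> A \<and> b \<in> A)) \<and>
    (\<forall>i\<in>Field r. \<forall>a\<in>M. \<forall>b\<in>M.
           (a, b) \<in> E i \<longleftrightarrow> (\<exists>A\<in>classes M E i. \<exists>B\<in>classes M E i.
              (a, (i, A)) \<in> mem_rel r M E \<and> (b, (i, B)) \<in> mem_rel r M E \<and>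
              consistent r (internal_system r M E) (i, A) (i, B)))"
proof -
  interpret fixed_D_set D r M E using assms by unfold_locales
  show ?thesis
    \<comment> \<open>Apart from side conditions, what remains after \<open>intro\<close> is the
      pair of equivalences in the second conjunct; there consistency and \<open>maps\<close> both
      rewrite to \<open>A = B\<close>.\<close>
    by (intro conjI ballI is_system_AP[OF assms(4)] is_target_AP Ext_AP related_iff
        related_iff_consistent)
      (simp_all only: consistent_AP_iff_eq maps_AP_iff_eq)
qed

end
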